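(* Let $u\in M_n(\mathbb C)$ be a unitary matrix, and let $\Delta_n$ and $u\Delta_nu^*$ be the corresponding two Masas in $M_n(\mathbb C)$. Then the Pimsner-Popa constant is $$\lambda(\Delta_n,u\Delta_nu^* )=\min_{1\le i\le n}\big(h\left((u^* )_i\right)\big)^{-1},$$ where $(u^* )_i$ is the $i$-th column of $u^*$ and $h$ denotes the Hamming number of a vector in $\mathbb C^n$.
   Context: $\Delta_n\subset M_n(\mathbb C)$ is the subalgebra of diagonal matrices. The Hamming number $h(x)$ of a nonzero vector $x\in\mathbb C^n$ is the number of its nonzero entries. For von Neumann subalgebras $\mathcal P,\mathcal Q$ of a finite von Neumann algebra $\mathcal M$ with fixed faithful normal trace (here the normalized trace of $M_n(\mathbb C)$) and trace-preserving conditional expectation $E^{\mathcal M}_{\mathcal Q}$, the Pimsner-Popa constant is $\lambda(\mathcal P,\mathcal Q)=\sup\{t\ge0:E^{\mathcal M}_{\mathcal Q}(x)\ge tx\ \ \forall x\in\mathcal P_+\}$. *)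

theory Defs
  imports "HOL-Analysis.Analysis" "HOL-Library.Complex_Order"
begin

text \<open>The algebra of complex matrices of size n is rendered as \<open>complex ^ 'n ^ 'n\<close>, with
  \<open>n = CARD('n) \<ge> 1\<close>; the index set \<open>{1, \<dots>, n}\<close> is the finite type \<open>'n\<close>.\<close>

definition adj :: "complex ^ 'n ^ 'n \<Rightarrow> complex ^ 'n ^ 'n" where
  "adj A = map_matrix cnj (transpose A)"

definition unitary_matrix :: "complex ^ 'n ^ 'n \<Rightarrow> bool" where
  "unitary_matrix u \<longleftrightarrow> adj u ** u = mat 1 \<and> u ** adj u = mat 1"

text \<open>Positivity in the operator sense. The order on \<^typ>\<open>complex\<close> is such that \<open>0 \<le> z\<close> means
  that \<open>z\<close> is real and nonnegative, so positive matrices are automatically Hermitian.\<close>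

definition positive_matrix :: "complex ^ 'n ^ 'n \<Rightarrow> bool" where
  "positive_matrix A \<longleftrightarrow> (\<forall>v. 0 \<le> (\<Sum>i\<in>UNIV. cnj (v $ i) * (A *v v) $ i))"

definition matrix_le :: "complex ^ 'n ^ 'n \<Rightarrow> complex ^ 'n ^ 'n \<Rightarrow> bool" where
  "matrix_le A B \<longleftrightarrow> positive_matrix (B - A)"

definition normalized_trace :: "complex ^ 'n ^ 'n \<Rightarrow> complex" where
  "normalized_trace A = trace A / of_nat CARD('n)"

text \<open>\<open>trace_preserving_cond_exp Q E\<close>: the map \<open>E\<close> is a conditional expectation of the full matrix
  algebra onto \<open>Q\<close> preserving the normalized trace. If \<open>Q\<close> is a unital *-subalgebra (which in
  finite dimension is the same as a von Neumann subalgebra), there is exactly one such map.\<close>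

definition trace_preserving_cond_exp ::
  "(complex ^ 'n ^ 'n) set \<Rightarrow> (complex ^ 'n ^ 'n \<Rightarrow> complex ^ 'n ^ 'n) \<Rightarrow> bool" where
  "trace_preserving_cond_exp Q E \<longleftrightarrow>
     (\<forall>x y. E (x + y) = E x + E y) \<and>
     (\<forall>c x. E (map_matrix ((*) c) x) = map_matrix ((*) c) (E x)) \<and>
     (\<forall>x. E x \<in> Q) \<and>
     (\<forall>q\<in>Q. E q = q) \<and>
     (\<forall>x. positive_matrix x \<longrightarrow> positive_matrix (E x)) \<and>
     (\<forall>a\<in>Q. \<forall>b\<in>Q. \<forall>x. E (a ** x ** b) = a ** E x ** b) \<and>
     (\<forall>x. normalized_trace (E x) = normalized_trace x)"

definition cond_exp :: "(complex ^ 'n ^ 'n) set \<Rightarrow> complex ^ 'n ^ 'n \<Rightarrow> complex ^ 'n ^ 'n" where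
  "cond_exp Q = (THE E. trace_preserving_cond_exp Q E)"

definition pimsner_popa ::
  "(complex ^ 'n ^ 'n) set \<Rightarrow> (complex ^ 'n ^ 'n) set \<Rightarrow> real" where
  "pimsner_popa P Q =
     Sup {t. 0 \<le> t \<and> (\<forall>x\<in>P. positive_matrix x \<longrightarrow> matrix_le (t *\<^sub>R x) (cond_exp Q x))}"

definition diagonal_algebra :: "(complex ^ 'n ^ 'n) set" where
  "diagonal_algebra = {A. \<forall>i j. i \<noteq> j \<longrightarrow> A $ i $ j = 0}"

definition unitary_conj :: "complex ^ 'n ^ 'n \<Rightarrow> (complex ^ 'n ^ 'n) set \<Rightarrow> (complex ^ 'n ^ 'n) set"
  where "unitary_conj u Q = (\<lambda>x. u ** x ** adj u) ` Q"

definition hamming_number :: "complex ^ 'n \<Rightarrow> nat" where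
  "hamming_number v = card {i. v $ i \<noteq> 0}"

end

theory Submission
  imports Defs
begin

text \<open>The conditional expectation onto \<open>u \<Delta> u\<^sup>*\<close> is \<open>x \<mapsto> u D(u\<^sup>* x u) u\<^sup>*\<close>, where
  \<open>D\<close> keeps the diagonal and erases everything else. It has the required properties because \<open>D\<close>
  has them for the diagonal algebra itself, and it is the only such map because a trace-preserving
  bimodule map satisfies \<open>tr (E(x) q) = tr (x q)\<close> for \<open>q\<close> in the subalgebra, and the
  projections \<open>u e\<^sub>j\<^sub>j u\<^sup>*\<close> already detect every element of \<open>u \<Delta> u\<^sup>*\<close>.

  Let \<open>x\<close> be diagonal with entries \<open>x\<^sub>k \<ge> 0\<close>. Writing the quadratic form of
  \<open>E(x) - t x\<close> at \<open>v = u w\<close> in terms of \<open>w\<close> gives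
  \<open>\<Sum>\<^sub>k x\<^sub>k (\<Sum>\<^sub>j |u\<^sub>k\<^sub>j|\<^sup>2 |w\<^sub>j|\<^sup>2 - t |\<Sum>\<^sub>j u\<^sub>k\<^sub>j w\<^sub>j|\<^sup>2)\<close>.
  Hence \<open>t\<close> is admissible if and only if each bracket is nonnegative for all \<open>w\<close>. By the
  Cauchy-Schwarz inequality over the support of the \<open>k\<close>-th row of \<open>u\<close>, this holds when
  \<open>t h\<^sub>k \<le> 1\<close>, where \<open>h\<^sub>k\<close> is the size of that support; the vector with entries
  \<open>1 / u\<^sub>k\<^sub>j\<close> on the support gives equality and so shows that the condition is necessary. The
  supremum of the admissible \<open>t\<close> is therefore the least \<open>1 / h\<^sub>k\<close>, and the \<open>k\<close>-th
  row of \<open>u\<close> has the same support as the \<open>k\<close>-th column of \<open>u\<^sup>*\<close>.\<close>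

section \<open>Adjoints, quadratic forms and diagonal matrices\<close>

lemma adj_nth [simp]: "adj A $ i $ j = cnj (A $ j $ i)"
  by (simp add: adj_def transpose_def map_matrix_def)

lemma adj_adj [simp]: "adj (adj A) = A"
  by (simp add: vec_eq_iff)

definition qform :: "complex ^ 'n ^ 'n \<Rightarrow> complex ^ 'n \<Rightarrow> complex" where
  "qform A v = (\<Sum>i\<in>UNIV. cnj (v $ i) * (A *v v) $ i)"

lemma positive_matrix_iff_qform: "positive_matrix A \<longleftrightarrow> (\<forall>v. 0 \<le> qform A v)"
  by (simp add: positive_matrix_def qform_def)

lemma sum_cnj_matrix_vector_mult:
  "(\<Sum>i\<in>UNIV. cnj (v $ i) * (B *v w) $ i) = (\<Sum>j\<in>UNIV. cnj ((adj B *v v) $ j) * w $ j)"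
  unfolding matrix_vector_mult_def
  by (simp add: sum_distrib_left sum_distrib_right cnj_sum mult_ac) (rule sum.swap)

lemma qform_conj: "qform (B ** A ** adj B) v = qform A (adj B *v v)"
  unfolding qform_def
  by (simp add: matrix_vector_mul_assoc [symmetric] sum_cnj_matrix_vector_mult)

lemma qform_diff: "qform (A - B) v = qform A v - qform B v"
  by (simp add: qform_def matrix_vector_mult_diff_rdistrib sum_subtractf algebra_simps)

lemma qform_scaleR: "qform (t *\<^sub>R A) v = t *\<^sub>R qform A v"
  by (simp add: qform_def matrix_vector_mult_def scaleR_sum_right sum_distrib_left)

lemma qform_axis: "qform A (axis i 1) = A $ i $ i"
proof -
  have "(A *v axis i 1) $ j = A $ j $ i" for j
    by (simp add: matrix_vector_mult_def axis_def if_distrib cong: if_cong)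
  then have "qform A (axis i 1) = (\<Sum>j\<in>UNIV. if j = i then A $ i $ i else 0)"
    unfolding qform_def
    by (intro sum.cong) (auto simp: axis_def)
  then show ?thesis by simp
qed

lemma of_real_cmod_squared: "(complex_of_real (cmod z))\<^sup>2 = z * cnj z"
  using complex_norm_square [of z] by simp

definition diag_part :: "complex ^ 'n ^ 'n \<Rightarrow> complex ^ 'n ^ 'n" where
  "diag_part A = (\<chi> i j. if i = j then A $ i $ j else 0)"

lemma diag_part_nth [simp]: "diag_part A $ i $ j = (if i = j then A $ i $ j else 0)"
  by (simp add: diag_part_def)

lemma diag_part_in_diagonal_algebra: "diag_part A \<in> diagonal_algebra"
  by (simp add: diagonal_algebra_def)

lemma diagonal_algebra_iff_diag_part: "A \<in> diagonal_algebra \<longleftrightarrow> diag_part A = A"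
  by (auto simp: diagonal_algebra_def vec_eq_iff)

lemma diagonal_mult_left: 
  assumes "a \<in> diagonal_algebra"
  shows "(a ** x) $ i $ j = a $ i $ i * x $ i $ j"
proof -
  have "(a ** x) $ i $ j = (\<Sum>k\<in>UNIV. if k = i then a $ i $ i * x $ i $ j else 0)"
    unfolding matrix_matrix_mult_def vec_lambda_beta
    by (rule sum.cong) (use assms in \<open>auto simp: diagonal_algebra_def\<close>)
  then show ?thesis by simp
qed

lemma diagonal_mult_right: 
  assumes "b \<in> diagonal_algebra"
  shows "(x ** b) $ i $ j = x $ i $ j * b $ j $ j"
proof -
  have "(x ** b) $ i $ j = (\<Sum>k\<in>UNIV. if k = j then x $ i $ j * b $ j $ j else 0)"
    unfolding matrix_matrix_mult_def vec_lambda_beta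
    by (rule sum.cong) (use assms in \<open>auto simp: diagonal_algebra_def\<close>)
  then show ?thesis by simp
qed

lemma diag_part_bimodule:
  assumes "a \<in> diagonal_algebra" "b \<in> diagonal_algebra"
  shows "diag_part (a ** x ** b) = a ** diag_part x ** b"
  using assms by (simp add: vec_eq_iff diagonal_mult_left diagonal_mult_right)

lemma qform_diag_part: "qform (diag_part A) v = (\<Sum>i\<in>UNIV. A $ i $ i * (cmod (v $ i))\<^sup>2)"
proof -
  have "(diag_part A *v v) $ i = A $ i $ i * v $ i" for i
    by (simp add: matrix_vector_mult_def if_distrib [of "\<lambda>z. z * _"] cong: if_cong)
  then show ?thesis
    by (simp add: qform_def of_real_cmod_squared mult_ac)
qed

lemma positive_matrix_diagonal_entry: "positive_matrix A \<Longrightarrow> 0 \<le> A $ i $ i"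
  by (metis positive_matrix_iff_qform qform_axis)

lemma positive_matrix_diag_part:
  assumes "positive_matrix A"
  shows "positive_matrix (diag_part A)"
  unfolding positive_matrix_iff_qform qform_diag_part
  using positive_matrix_diagonal_entry [OF assms]
  by (auto intro!: sum_nonneg mult_nonneg_nonneg simp: less_eq_complex_def)

lemma positive_matrix_conj: "positive_matrix A \<Longrightarrow> positive_matrix (B ** A ** adj B)"
  by (simp add: positive_matrix_iff_qform qform_conj)

section \<open>The conditional expectation onto a conjugate of the diagonal algebra\<close>

definition conj_diag_exp :: "complex ^ 'n ^ 'n \<Rightarrow> complex ^ 'n ^ 'n \<Rightarrow> complex ^ 'n ^ 'n" where
  "conj_diag_exp u x = u ** diag_part (adj u ** x ** u) ** adj u"

lemma map_matrix_mult_left: "map_matrix ((*) (c::complex)) A ** B = map_matrix ((*) c) (A ** B)"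
  by (simp add: vec_eq_iff matrix_matrix_mult_def map_matrix_def sum_distrib_left mult_ac)

lemma map_matrix_mult_right: "A ** map_matrix ((*) (c::complex)) B = map_matrix ((*) c) (A ** B)"
  by (simp add: vec_eq_iff matrix_matrix_mult_def map_matrix_def sum_distrib_left mult_ac)

lemma matrix_mult_distrib_right: "(A + B) ** C = A ** C + B ** (C :: complex ^ 'n ^ 'm)"
  by (simp add: vec_eq_iff matrix_matrix_mult_def distrib_right sum.distrib)

lemma unitary_cancel:
  assumes "unitary_matrix u"
  shows "adj u ** (u ** x) = x" "u ** (adj u ** x) = x"
    and "adj u ** u = mat 1" "u ** adj u = mat 1"
  using assms by (auto simp: unitary_matrix_def matrix_mul_assoc)

lemma trace_conj_diag_exp:
  assumes "unitary_matrix u"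
  shows "trace (conj_diag_exp u x) = trace x"
proof -
  have "trace (conj_diag_exp u x) = trace (diag_part (adj u ** x ** u))"
    unfolding conj_diag_exp_def
    by (subst trace_mul_sym) (simp add: unitary_cancel [OF assms] matrix_mul_assoc)
  also have "\<dots> = trace (adj u ** x ** u)"
    by (simp add: trace_def)
  also have "\<dots> = trace x"
    by (subst trace_mul_sym) (simp add: unitary_cancel [OF assms] matrix_mul_assoc)
  finally show ?thesis .
qed

lemma trace_preserving_conj_diag_exp:
  fixes u :: "complex ^ 'n ^ 'n"
  assumes u: "unitary_matrix u"
  shows "trace_preserving_cond_exp (unitary_conj u diagonal_algebra) (conj_diag_exp u)"
  unfolding trace_preserving_cond_exp_def
proof (intro conjI allI ballI impI)
  fix x y :: "complex ^ 'n ^ 'n" and c :: complex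
  have add: "diag_part (A + B) = diag_part A + diag_part B" for A B :: "complex ^ 'n ^ 'n"
    by (simp add: vec_eq_iff)
  show "conj_diag_exp u (x + y) = conj_diag_exp u x + conj_diag_exp u y"
    by (simp add: conj_diag_exp_def matrix_add_ldistrib matrix_mult_distrib_right add)
  have scale: "diag_part (map_matrix ((*) c) A) = map_matrix ((*) c) (diag_part A)"
    for A :: "complex ^ 'n ^ 'n"
    by (simp add: vec_eq_iff map_matrix_def)
  show "conj_diag_exp u (map_matrix ((*) c) x) = map_matrix ((*) c) (conj_diag_exp u x)"
    by (simp add: conj_diag_exp_def map_matrix_mult_left map_matrix_mult_right scale)
  show "conj_diag_exp u x \<in> unitary_conj u diagonal_algebra"
    by (auto simp: conj_diag_exp_def unitary_conj_def diag_part_in_diagonal_algebra)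
  show "normalized_trace (conj_diag_exp u x) = normalized_trace x"
    by (simp add: normalized_trace_def trace_conj_diag_exp [OF u])
next
  fix q assume "q \<in> unitary_conj u diagonal_algebra"
  then show "conj_diag_exp u q = q"
    by (auto simp: conj_diag_exp_def unitary_conj_def unitary_cancel [OF u]
        diagonal_algebra_iff_diag_part matrix_mul_assoc [symmetric])
next
  fix x :: "complex ^ 'n ^ 'n" assume "positive_matrix x"
  then have "positive_matrix (adj u ** x ** adj (adj u))"
    by (rule positive_matrix_conj)
  then show "positive_matrix (conj_diag_exp u x)"
    by (simp add: conj_diag_exp_def positive_matrix_conj positive_matrix_diag_part)
next
  fix a b x :: "complex ^ 'n ^ 'n"
  assume "a \<in> unitary_conj u diagonal_algebra" "b \<in> unitary_conj u diagonal_algebra"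
  then obtain c d where cd: "c \<in> diagonal_algebra" "d \<in> diagonal_algebra"
    "a = u ** c ** adj u" "b = u ** d ** adj u"
    by (auto simp: unitary_conj_def)
  have "adj u ** (a ** x ** b) ** u = c ** (adj u ** x ** u) ** d"
    by (simp add: cd unitary_cancel [OF u] matrix_mul_assoc [symmetric])
  then have "diag_part (adj u ** (a ** x ** b) ** u) = c ** diag_part (adj u ** x ** u) ** d"
    by (simp only: diag_part_bimodule cd)
  then show "conj_diag_exp u (a ** x ** b) = a ** conj_diag_exp u x ** b"
    by (simp add: conj_diag_exp_def cd unitary_cancel [OF u]
        matrix_mul_assoc [symmetric])
qed

text \<open>The entry \<open>(u\<^sup>* x u)\<^sub>j\<^sub>j\<close> equals \<open>tr (x q)\<close> with \<open>q = u e\<^sub>j\<^sub>j u\<^sup>*\<close>,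
  and \<open>tr (E(x) q) = tr (E(x q)) = tr (x q)\<close> since \<open>q\<close> lies in the subalgebra. So the
  defining properties of \<open>E\<close> leave no freedom in the coefficients of \<open>E(x)\<close>.\<close>

lemma trace_preserving_cond_exp_unique:
  fixes u :: "complex ^ 'n ^ 'n"
  assumes u: "unitary_matrix u"
    and E: "trace_preserving_cond_exp (unitary_conj u diagonal_algebra) E"
  shows "E = conj_diag_exp u"
proof
  fix x
  define Q where "Q = unitary_conj u diagonal_algebra"
  have "E x \<in> Q"
    using E by (simp add: trace_preserving_cond_exp_def Q_def)
  then obtain d where d: "d \<in> diagonal_algebra" "E x = u ** d ** adj u"
    by (auto simp: unitary_conj_def Q_def)
  have dx: "adj u ** E x ** u = d"
    by (simp add: d unitary_cancel [OF u] matrix_mul_assoc [symmetric])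
  have one: "mat 1 \<in> Q"
    unfolding unitary_conj_def Q_def
    by (rule image_eqI [where x = "mat 1"])
      (simp_all add: unitary_cancel [OF u], simp add: diagonal_algebra_def mat_def)
  have "d $ j $ j = (adj u ** x ** u) $ j $ j" for j
  proof -
    define e :: "complex ^ 'n ^ 'n" where "e = (\<chi> k l. if k = j \<and> l = j then 1 else 0)"
    define q where "q = u ** e ** adj u"
    have e: "e \<in> diagonal_algebra"
      by (auto simp: e_def diagonal_algebra_def)
    then have q: "q \<in> Q"
      by (auto simp: q_def Q_def unitary_conj_def)
    have entry: "trace (y ** q) = (adj u ** y ** u) $ j $ j" for y
    proof -
      have "trace (y ** q) = trace ((y ** u ** e) ** adj u)"
        by (simp add: q_def matrix_mul_assoc)
      also have "\<dots> = trace ((adj u ** y ** u) ** e)"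
        by (subst trace_mul_sym) (simp add: matrix_mul_assoc)
      also have "\<dots> = (adj u ** y ** u) $ j $ j"
        by (simp only: trace_def diagonal_mult_right [OF e])
          (simp add: e_def if_distrib [of "\<lambda>z. _ * z"] cong: if_cong)
      finally show ?thesis .
    qed
    have "E (mat 1 ** x ** q) = mat 1 ** E x ** q"
      using E one q unfolding trace_preserving_cond_exp_def Q_def by blast
    then have "normalized_trace (E x ** q) = normalized_trace (x ** q)"
      using E by (metis matrix_mul_lid trace_preserving_cond_exp_def)
    then have "trace (E x ** q) = trace (x ** q)"
      by (simp add: normalized_trace_def)
    then show ?thesis
      by (simp only: entry dx)
  qed
  then have "diag_part d = diag_part (adj u ** x ** u)"
    by (simp add: vec_eq_iff)
  then show "E x = conj_diag_exp u x"
    using d by (simp add: conj_diag_exp_def diagonal_algebra_iff_diag_part)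
qed

lemma cond_exp_unitary_conj_diagonal_algebra:
  assumes "unitary_matrix u"
  shows "cond_exp (unitary_conj u diagonal_algebra) = conj_diag_exp u"
  unfolding cond_exp_def
  using trace_preserving_conj_diag_exp [OF assms] trace_preserving_cond_exp_unique [OF assms]
  by (rule the_equality)

section \<open>The admissible constants\<close>

lemma cmod_sum_mult_squared_le:
  fixes a w :: "'a::finite \<Rightarrow> complex"
  shows "(cmod (\<Sum>j\<in>UNIV. a j * w j))\<^sup>2
    \<le> card {j. a j \<noteq> 0} * (\<Sum>j\<in>UNIV. (cmod (a j))\<^sup>2 * (cmod (w j))\<^sup>2)"
proof -
  have supp: "(\<Sum>j\<in>UNIV. a j * w j) = (\<Sum>j\<in>{j. a j \<noteq> 0}. a j * w j)"
    by (rule sum.mono_neutral_right) auto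
  have "(cmod (\<Sum>j\<in>UNIV. a j * w j))\<^sup>2 \<le> (\<Sum>j\<in>{j. a j \<noteq> 0}. cmod (a j * w j))\<^sup>2"
    unfolding supp by (intro power_mono norm_sum) simp
  also have "\<dots> \<le> (\<Sum>j\<in>{j. a j \<noteq> 0}. (cmod (a j * w j))\<^sup>2) * card {j. a j \<noteq> 0}"
    by (rule sum_squared_le_sum_of_squares)
  also have "(\<Sum>j\<in>{j. a j \<noteq> 0}. (cmod (a j * w j))\<^sup>2)
      = (\<Sum>j\<in>UNIV. (cmod (a j))\<^sup>2 * (cmod (w j))\<^sup>2)"
    by (rule sum.mono_neutral_cong_left) (auto simp: norm_mult power_mult_distrib)
  finally show ?thesis by (simp add: mult.commute)
qed

text \<open>The vector of reciprocals on the support makes every term \<open>a\<^sub>j w\<^sub>j\<close> equal to \<open>1\<close>,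
  which is the equality case of the Cauchy-Schwarz inequality, so \<open>t \<le> 1 / h\<close> cannot be
  improved.\<close>

lemma weighted_sum_bound_iff:
  fixes a :: "'a::finite \<Rightarrow> complex" and t :: real
  defines "h \<equiv> card {j. a j \<noteq> 0}"
  assumes "0 \<le> t" and nz: "h > 0"
  shows "(\<forall>w::'a \<Rightarrow> complex. t * (cmod (\<Sum>j\<in>UNIV. a j * w j))\<^sup>2
            \<le> (\<Sum>j\<in>UNIV. (cmod (a j))\<^sup>2 * (cmod (w j))\<^sup>2)) \<longleftrightarrow> t \<le> inverse (real h)"
    (is "?bound \<longleftrightarrow> _")
proof
  assume ?bound
  define w where "w = (\<lambda>j. if a j = 0 then 0 else inverse (a j))"
  have "(\<Sum>j\<in>UNIV. a j * w j) = (\<Sum>j\<in>{j. a j \<noteq> 0}. 1)"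
    by (rule sum.mono_neutral_cong_right) (auto simp: w_def)
  then have s1: "(\<Sum>j\<in>UNIV. a j * w j) = of_nat h"
    by (simp add: h_def)
  have "(\<Sum>j\<in>UNIV. (cmod (a j))\<^sup>2 * (cmod (w j))\<^sup>2) = (\<Sum>j\<in>{j. a j \<noteq> 0}. 1)"
    by (rule sum.mono_neutral_cong_right)
      (auto simp: w_def norm_inverse power_mult_distrib [symmetric])
  then have s2: "(\<Sum>j\<in>UNIV. (cmod (a j))\<^sup>2 * (cmod (w j))\<^sup>2) = real h"
    by (simp add: h_def)
  have "t * (real h)\<^sup>2 \<le> real h"
    using \<open>?bound\<close> [rule_format, of w] by (simp add: s1 s2)
  then show "t \<le> inverse (real h)"
    using nz by (simp add: field_simps power2_eq_square)
next
  assume t: "t \<le> inverse (real h)"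
  show ?bound
  proof
    fix w :: "'a \<Rightarrow> complex"
    let ?s = "\<Sum>j\<in>UNIV. (cmod (a j))\<^sup>2 * (cmod (w j))\<^sup>2"
    have "t * (cmod (\<Sum>j\<in>UNIV. a j * w j))\<^sup>2 \<le> t * (real h * ?s)"
      unfolding h_def by (intro mult_left_mono cmod_sum_mult_squared_le \<open>0 \<le> t\<close>)
    also have "\<dots> = (t * real h) * ?s" by simp
    also have "\<dots> \<le> 1 * ?s"
      using t nz by (intro mult_right_mono sum_nonneg) (auto simp: field_simps)
    finally show "t * (cmod (\<Sum>j\<in>UNIV. a j * w j))\<^sup>2 \<le> ?s" by simp
  qed
qed

lemma conj_diagonal_entry:
  assumes "x \<in> diagonal_algebra"
  shows "(adj u ** x ** u) $ j $ j = (\<Sum>k\<in>UNIV. x $ k $ k * (cmod (u $ k $ j))\<^sup>2)"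
proof -
  have "(adj u ** x ** u) $ j $ j = (\<Sum>k\<in>UNIV. (adj u ** x) $ j $ k * u $ k $ j)"
    by (simp only: matrix_matrix_mult_def vec_lambda_beta)
  also have "\<dots> = (\<Sum>k\<in>UNIV. x $ k $ k * (cmod (u $ k $ j))\<^sup>2)"
    unfolding diagonal_mult_right [OF assms] by (simp add: of_real_cmod_squared mult_ac)
  finally show ?thesis .
qed

text \<open>In the coordinates \<open>w = u\<^sup>* v\<close> the form of \<open>E(x)\<close> is diagonal. Exchanging the
  two summations then groups both forms by the entries of \<open>x\<close>.\<close>

lemma qform_conj_diag_exp_diff:
  fixes u x :: "complex ^ 'n ^ 'n" and w :: "complex ^ 'n"
  assumes u: "unitary_matrix u" and x: "x \<in> diagonal_algebra"
  shows "qform (conj_diag_exp u x - t *\<^sub>R x) (u *v w) =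
    (\<Sum>k\<in>UNIV. x $ k $ k * complex_of_real
      ((\<Sum>j\<in>UNIV. (cmod (u $ k $ j))\<^sup>2 * (cmod (w $ j))\<^sup>2)
        - t * (cmod (\<Sum>j\<in>UNIV. u $ k $ j * w $ j))\<^sup>2))"
proof -
  have "adj u *v (u *v w) = w"
    by (simp add: matrix_vector_mul_assoc unitary_cancel [OF u])
  then have "qform (conj_diag_exp u x) (u *v w) = 
      (\<Sum>j\<in>UNIV. (\<Sum>k\<in>UNIV. x $ k $ k * (cmod (u $ k $ j))\<^sup>2) * (cmod (w $ j))\<^sup>2)"
    by (simp add: conj_diag_exp_def qform_conj qform_diag_part conj_diagonal_entry [OF x])
  also have "\<dots> = (\<Sum>k\<in>UNIV. \<Sum>j\<in>UNIV. x $ k $ k * (cmod (u $ k $ j))\<^sup>2 * (cmod (w $ j))\<^sup>2)"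
    unfolding sum_distrib_right by (rule sum.swap)
  finally have 1: "qform (conj_diag_exp u x) (u *v w) = \<dots>" .
  have 2: "qform x (u *v w) =
      (\<Sum>k\<in>UNIV. x $ k $ k * (cmod (\<Sum>j\<in>UNIV. u $ k $ j * w $ j))\<^sup>2)"
    using qform_diag_part [of x "u *v w"] x
    by (simp add: diagonal_algebra_iff_diag_part matrix_vector_mult_def)
  show ?thesis
    unfolding qform_diff qform_scaleR 1 2
    by (simp add: scaleR_conv_of_real sum_distrib_left sum_subtractf algebra_simps)
qed

text \<open>Testing on the matrix units \<open>e\<^sub>k\<^sub>k\<close> isolates the summand with index
  \<open>k\<close> of the quadratic form, and nonnegative combinations of these units make
  up the whole positive cone of the diagonal algebra.\<close>

lemma conj_diag_exp_bound_iff: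
  fixes u :: "complex ^ 'n ^ 'n"
  assumes u: "unitary_matrix u"
  shows "(\<forall>x\<in>diagonal_algebra. positive_matrix x \<longrightarrow> matrix_le (t *\<^sub>R x) (conj_diag_exp u x))
    \<longleftrightarrow> (\<forall>k. \<forall>w::'n \<Rightarrow> complex. t * (cmod (\<Sum>j\<in>UNIV. u $ k $ j * w j))\<^sup>2
            \<le> (\<Sum>j\<in>UNIV. (cmod (u $ k $ j))\<^sup>2 * (cmod (w j))\<^sup>2))" (is "?L \<longleftrightarrow> ?R")
proof
  assume ?L
  show ?R
  proof (intro allI)
    fix k and w :: "'n \<Rightarrow> complex"
    define e :: "complex ^ 'n ^ 'n" where "e = diag_part (\<chi> i j. if i = k then 1 else 0)"
    have e: "e \<in> diagonal_algebra"
      by (simp add: e_def diag_part_in_diagonal_algebra)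
    have "positive_matrix e"
      unfolding positive_matrix_iff_qform e_def qform_diag_part
      by (intro allI sum_nonneg mult_nonneg_nonneg) (auto simp: less_eq_complex_def)
    with \<open>?L\<close> e have "0 \<le> qform (conj_diag_exp u e - t *\<^sub>R e) (u *v (\<chi> j. w j))"
      by (simp add: matrix_le_def positive_matrix_iff_qform)
    also have "\<dots> = complex_of_real ((\<Sum>j\<in>UNIV. (cmod (u $ k $ j))\<^sup>2 * (cmod (w j))\<^sup>2)
        - t * (cmod (\<Sum>j\<in>UNIV. u $ k $ j * w j))\<^sup>2)"
      unfolding qform_conj_diag_exp_diff [OF u e]
      by (simp add: e_def if_distrib [of "\<lambda>z. z * _"] cong: if_cong)
    finally show "t * (cmod (\<Sum>j\<in>UNIV. u $ k $ j * w j))\<^sup>2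
        \<le> (\<Sum>j\<in>UNIV. (cmod (u $ k $ j))\<^sup>2 * (cmod (w j))\<^sup>2)"
      unfolding less_eq_complex_def by simp
  qed
next
  assume R: ?R
  show ?L
    unfolding matrix_le_def positive_matrix_iff_qform
  proof (intro ballI impI allI)
    fix x :: "complex ^ 'n ^ 'n" and v
    assume x: "x \<in> diagonal_algebra" and pos: "\<forall>v. 0 \<le> qform x v"
    have v: "v = u *v (adj u *v v)"
      by (simp add: matrix_vector_mul_assoc unitary_cancel [OF u])
    have "0 \<le> x $ k $ k" for k
      using pos by (metis qform_axis)
    then show "0 \<le> qform (conj_diag_exp u x - t *\<^sub>R x) v"
      using R
      by (subst v, subst qform_conj_diag_exp_diff [OF u x])
        (intro sum_nonneg mult_nonneg_nonneg, auto simp: less_eq_complex_def)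
  qed
qed

lemma hamming_number_column_adj:
  "hamming_number (column i (adj u)) = card {j. u $ i $ j \<noteq> 0}"
  by (simp add: hamming_number_def column_def)

lemma unitary_row_support_pos:
  assumes "unitary_matrix u"
  shows "card {j. u $ i $ j \<noteq> 0} > 0"
proof (rule ccontr)
  assume "\<not> ?thesis"
  then have "u $ i $ j = 0" for j by (simp add: card_eq_0_iff)
  then have "(u ** adj u) $ i $ i = 0"
    by (simp add: matrix_matrix_mult_def)
  then show False
    by (simp add: unitary_cancel [OF assms] mat_def)
qed

theorem theorem1p17:
  fixes u :: "complex ^ 'n ^ 'n"
  assumes "unitary_matrix u"
  shows "pimsner_popa diagonal_algebra (unitary_conj u diagonal_algebra)
           = (MIN i. inverse (real (hamming_number (column i (adj u)))))"
proof -
  let ?h = "\<lambda>i. inverse (real (hamming_number (column i (adj u))))"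
  let ?m = "MIN i. ?h i"
  have "{t. 0 \<le> t \<and> (\<forall>x\<in>diagonal_algebra. positive_matrix x \<longrightarrow>
            matrix_le (t *\<^sub>R x) (cond_exp (unitary_conj u diagonal_algebra) x))}
      = {t. 0 \<le> t \<and> (\<forall>i. t \<le> ?h i)}"
    unfolding cond_exp_unitary_conj_diagonal_algebra [OF assms]
      conj_diag_exp_bound_iff [OF assms] hamming_number_column_adj
    using unitary_row_support_pos [OF assms]
    by (intro Collect_cong conj_cong refl all_cong1 weighted_sum_bound_iff)
  also have "\<dots> = {0..?m}"
    by auto
  finally have "pimsner_popa diagonal_algebra (unitary_conj u diagonal_algebra) = Sup {0..?m}"
    by (simp add: pimsner_popa_def)
  moreover have "0 \<le> ?m"
    by simp
  ultimately show ?thesis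
    by simp
qed

end
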